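(* Let $G$ be a finite nonabelian group. If $G$ has only inner automorphisms then, for regular $G$-stable subgroups of $\mathrm{Perm}(G)$, brace equivalence implies $G$-isomorphism; that is, if $N,M$ are regular $G$-stable subgroups of $\mathrm{Perm}(G)$ that are brace equivalent, then $N$ and $M$ are $G$-isomorphic.
   Context: $\mathrm{Perm}(G)$ is the group of permutations of $G$; $\lambda:G\to\mathrm{Perm}(G)$ is given by $\lambda(\sigma)[\tau]=\sigma\tau$. $G$ acts on $\mathrm{Perm}(G)$ by ${}^{\sigma}\pi=\lambda(\sigma)\pi\lambda(\sigma)^{-1}$. A subgroup $N\le\mathrm{Perm}(G)$ is regular if it acts transitively on $G$ with trivial stabilizers, and $G$-stable if ${}^{\sigma}\eta\in N$ for all $\sigma\in G$, $\eta\in N$. Two regular $G$-stable subgroups $N,M$ are $G$-isomorphic if there is a group isomorphism $\theta:N\to M$ with $\theta({}^{\sigma}\eta)={}^{\sigma}\theta(\eta)$ for all $\eta\in N$, $\sigma\in G$. A brace (skew left brace) is a triple $(B,\cdot,\circ)$ where $(B,\cdot)$ and $(B,\circ)$ are finite groups with $x\circ(y\cdot z)=(x\circ y)\cdot x^{-1}\cdot(x\circ z)$ for all $x,y,z\in B$ ($x^{-1}$ being the inverse in $(B,\cdot)$); an isomorphism of braces is a bijection respecting both operations. For a regular $G$-stable subgroup $N$, the map $a:N\to G$, $a(\eta)=\eta[1_G]$, is a bijection, and $\mathfrak{B}_N=(N,\cdot,\circ)$, with $\cdot$ the composition in $N$ and $\eta\circ\pi=a^{-1}(a(\eta)a(\pi))$,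 is a brace. Two regular $G$-stable subgroups $N,M$ of $\mathrm{Perm}(G)$ are brace equivalent if $\mathfrak{B}_N\cong\mathfrak{B}_M$ as braces. *)

theory Defs
  imports "HOL-Algebra.Group_Action"
begin

section \<open>Regular stable subgroups of the permutation group of a group\<close>

text \<open>Elements of \<open>Bij (carrier G)\<close>, hence of \<open>Perm G\<close> and \<open>auto G\<close>, are extensional, so that distinct
  functions are distinct permutations; \<open>left_reg\<close> and \<open>Inn\<close> are restricted to match.\<close>

abbreviation Perm :: "('a, 'm) monoid_scheme \<Rightarrow> ('a \<Rightarrow> 'a) monoid" where
  "Perm G \<equiv> BijGroup (carrier G)"

definition left_reg :: "('a, 'm) monoid_scheme \<Rightarrow> 'a \<Rightarrow> 'a \<Rightarrow> 'a" where
  "left_reg G \<sigma> = (\<lambda>\<tau>\<in>carrier G. \<sigma> \<otimes>\<^bsub>G\<^esub> \<tau>)"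

definition perm_act :: "('a, 'm) monoid_scheme \<Rightarrow> 'a \<Rightarrow> ('a \<Rightarrow> 'a) \<Rightarrow> ('a \<Rightarrow> 'a)" where
  "perm_act G \<sigma> \<pi> =
     left_reg G \<sigma> \<otimes>\<^bsub>Perm G\<^esub> \<pi> \<otimes>\<^bsub>Perm G\<^esub> inv\<^bsub>Perm G\<^esub> (left_reg G \<sigma>)"

definition regular_subgroup :: "('a \<Rightarrow> 'a) set \<Rightarrow> ('a, 'm) monoid_scheme \<Rightarrow> bool" where
  "regular_subgroup N G \<longleftrightarrow>
     subgroup N (Perm G) \<and>
     transitive_action (Perm G\<lparr>carrier := N\<rparr>) (carrier G) (\<lambda>\<eta>. \<eta>) \<and>
     (\<forall>x\<in>carrier G. stabilizer (Perm G\<lparr>carrier := N\<rparr>) (\<lambda>\<eta>. \<eta>) x = {\<one>\<^bsub>Perm G\<^esub>})"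

definition stable_under :: "('a \<Rightarrow> 'a) set \<Rightarrow> ('a, 'm) monoid_scheme \<Rightarrow> bool" where
  "stable_under N G \<longleftrightarrow> (\<forall>\<sigma>\<in>carrier G. \<forall>\<eta>\<in>N. perm_act G \<sigma> \<eta> \<in> N)"

definition G_isomorphic ::
  "('a, 'm) monoid_scheme \<Rightarrow> ('a \<Rightarrow> 'a) set \<Rightarrow> ('a \<Rightarrow> 'a) set \<Rightarrow> bool" where
  "G_isomorphic G N M \<longleftrightarrow>
     (\<exists>\<theta> \<in> iso (Perm G\<lparr>carrier := N\<rparr>) (Perm G\<lparr>carrier := M\<rparr>).
        \<forall>\<eta>\<in>N. \<forall>\<sigma>\<in>carrier G. \<theta> (perm_act G \<sigma> \<eta>) = perm_act G \<sigma> (\<theta> \<eta>))"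

definition Inn :: "('a, 'm) monoid_scheme \<Rightarrow> ('a \<Rightarrow> 'a) set" where
  "Inn G = {\<lambda>x\<in>carrier G. g \<otimes>\<^bsub>G\<^esub> x \<otimes>\<^bsub>G\<^esub> inv\<^bsub>G\<^esub> g | g. g \<in> carrier G}"


section \<open>Skew left braces\<close>

record 'a brace = "'a monoid" +
  circ :: "'a \<Rightarrow> 'a \<Rightarrow> 'a" (infixl \<open>\<circ>\<^sub>b\<index>\<close> 70)

text \<open>The brace relation with \<open>y\<close> and \<open>z\<close> equal to \<open>\<one>\<close> gives \<open>x \<circ> \<one> = x\<close>, so \<open>\<one>\<close> is the
  only possible identity of the second operation; the record therefore has only one identity field.\<close>

definition circ_group :: "('a, 'm) brace_scheme \<Rightarrow> 'a monoid" where
  "circ_group B = \<lparr>carrier = carrier B, mult = circ B, one = \<one>\<^bsub>B\<^esub>\<rparr>"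

locale skew_brace = group B for B :: "('a, 'm) brace_scheme" (structure) +
  assumes circ_group: "group (circ_group B)"
    and finite_carrier: "finite (carrier B)"
    and brace_relation: "\<lbrakk>x \<in> carrier B; y \<in> carrier B; z \<in> carrier B\<rbrakk> \<Longrightarrow>
          x \<circ>\<^sub>b (y \<otimes> z) = (x \<circ>\<^sub>b y) \<otimes> inv x \<otimes> (x \<circ>\<^sub>b z)"

definition brace_iso :: "('a, 'm) brace_scheme \<Rightarrow> ('b, 'n) brace_scheme \<Rightarrow> ('a \<Rightarrow> 'b) set" where
  "brace_iso A B = iso A B \<inter> iso (circ_group A) (circ_group B)"

definition base_eval :: "('a, 'm) monoid_scheme \<Rightarrow> ('a \<Rightarrow> 'a) \<Rightarrow> 'a" where
  "base_eval G \<eta> = \<eta> \<one>\<^bsub>G\<^esub>"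

text \<open>\<open>inv_into N (base_eval G)\<close> is meaningful because \<open>base_eval G\<close> maps a regular \<open>N\<close> bijectively
  onto \<open>carrier G\<close>; see \<open>bij_betw_base_eval\<close> below.\<close>

definition brace_of :: "('a, 'm) monoid_scheme \<Rightarrow> ('a \<Rightarrow> 'a) set \<Rightarrow> ('a \<Rightarrow> 'a) brace" where
  "brace_of G N =
     \<lparr>carrier = N, mult = mult (Perm G), one = \<one>\<^bsub>Perm G\<^esub>,
      circ = (\<lambda>\<eta> \<pi>. inv_into N (base_eval G) (base_eval G \<eta> \<otimes>\<^bsub>G\<^esub> base_eval G \<pi>))\<rparr>"

definition brace_equivalent ::
  "('a, 'm) monoid_scheme \<Rightarrow> ('a \<Rightarrow> 'a) set \<Rightarrow> ('a \<Rightarrow> 'a) set \<Rightarrow> bool" where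
  "brace_equivalent G N M \<longleftrightarrow> brace_iso (brace_of G N) (brace_of G M) \<noteq> {}"


section \<open>The structure attached to a regular stable subgroup is a brace\<close>

lemma bij_betw_base_eval:
  assumes "group G" "regular_subgroup N G"
  shows "bij_betw (base_eval G) N (carrier G)"
proof -
  interpret group G by fact
  interpret P: group "Perm G" by (rule group_BijGroup)
  interpret S: subgroup N "Perm G" using assms(2) by (simp add: regular_subgroup_def)
  interpret A: transitive_action "Perm G\<lparr>carrier := N\<rparr>" "carrier G" "\<lambda>\<eta>. \<eta>"
    using assms(2) by (simp add: regular_subgroup_def)
  have NB: "N \<subseteq> Bij (carrier G)" using S.subset by (simp add: BijGroup_def)
  have app: "(x \<otimes>\<^bsub>Perm G\<^esub> y) t = x (y t)" if "x \<in> N" "y \<in> N" "t \<in> carrier G" for x y t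
    using that NB by (auto simp: BijGroup_def compose_def)
  have "inj_on (base_eval G) N"
  proof (rule inj_onI)
    fix x y assume xy: "x \<in> N" "y \<in> N" "base_eval G x = base_eval G y"
    let ?z = "inv\<^bsub>Perm G\<^esub> y"
    have z: "?z \<in> N" using xy by simp
    have "(?z \<otimes>\<^bsub>Perm G\<^esub> x) \<one>\<^bsub>G\<^esub> = (?z \<otimes>\<^bsub>Perm G\<^esub> y) \<one>\<^bsub>G\<^esub>"
      using app[OF z xy(1)] app[OF z xy(2)] xy(3) by (simp only: base_eval_def one_closed)
    also have "\<dots> = \<one>\<^bsub>G\<^esub>"
      using P.l_inv[OF S.mem_carrier[OF xy(2)]] by (simp only:) (simp add: BijGroup_def)
    finally have "?z \<otimes>\<^bsub>Perm G\<^esub> x \<in> stabilizer (Perm G\<lparr>carrier := N\<rparr>) (\<lambda>\<eta>. \<eta>) \<one>\<^bsub>G\<^esub>"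
      using xy z by (simp add: stabilizer_def)
    hence "?z \<otimes>\<^bsub>Perm G\<^esub> x = \<one>\<^bsub>Perm G\<^esub>"
      using assms(2) by (auto simp: regular_subgroup_def)
    hence "inv\<^bsub>Perm G\<^esub> x = inv\<^bsub>Perm G\<^esub> y" using xy by (intro P.inv_equality) auto
    thus "x = y" using xy P.inv_inv S.mem_carrier by metis
  qed
  moreover have "base_eval G ` N = carrier G"
  proof
    show "base_eval G ` N \<subseteq> carrier G"
      using NB Bij_imp_funcset by (fastforce simp: base_eval_def)
    show "carrier G \<subseteq> base_eval G ` N"
      using A.unique_orbit[of "\<one>\<^bsub>G\<^esub>"] by (fastforce simp: base_eval_def)
  qed
  ultimately show ?thesis by (simp add: bij_betw_def)
qed

lemma skew_brace_brace_of:
  assumes "group G" "finite (carrier G)" "regular_subgroup N G" "stable_under N G"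
  shows "skew_brace (brace_of G N)"
proof -
  interpret group G by fact
  interpret P: group "Perm G" by (rule group_BijGroup)
  interpret S: subgroup N "Perm G" using assms(3) by (simp add: regular_subgroup_def)
  let ?B = "brace_of G N" and ?a = "base_eval G"
  let ?c = "inv_into N ?a"
  have bij: "bij_betw ?a N (carrier G)" by (rule bij_betw_base_eval) fact+
  have NB: "N \<subseteq> Bij (carrier G)" using S.subset by (simp add: BijGroup_def)
  have app: "(x \<otimes>\<^bsub>Perm G\<^esub> y) t = x (y t)"
    if "x \<in> carrier (Perm G)" "y \<in> carrier (Perm G)" "t \<in> carrier G" for x y t
    using that by (auto simp: BijGroup_def compose_def)
  have aN: "?a x \<in> carrier G" if "x \<in> N" for x
    using bij that by (rule bij_betw_apply)
  have cN: "?c g \<in> N" if "g \<in> carrier G" for g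
    using bij that by (metis bij_betw_def inv_into_into)
  have ac: "?a (?c g) = g" if "g \<in> carrier G" for g
    using bij that by (metis bij_betw_inv_into_right)
  have ca: "?c (?a x) = x" if "x \<in> N" for x
    using bij that by (metis bij_betw_inv_into_left)
  have a1: "?a \<one>\<^bsub>Perm G\<^esub> = \<one>\<^bsub>G\<^esub>" by (simp add: base_eval_def BijGroup_def)
  have circ: "circ ?B x y = ?c (?a x \<otimes>\<^bsub>G\<^esub> ?a y)" for x y by (simp add: brace_of_def)
  have [simp]: "carrier ?B = N" "mult ?B = mult (Perm G)" "\<one>\<^bsub>?B\<^esub> = \<one>\<^bsub>Perm G\<^esub>"
    by (simp_all add: brace_of_def)
  have gB: "group ?B"
  proof (rule groupI)
    fix x assume "x \<in> carrier ?B"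
    then show "\<exists>y\<in>carrier ?B. y \<otimes>\<^bsub>?B\<^esub> x = \<one>\<^bsub>?B\<^esub>"
      by (intro bexI[of _ "inv\<^bsub>Perm G\<^esub> x"]) auto
  qed (auto simp: P.m_assoc)
  have invB: "inv\<^bsub>?B\<^esub> x = inv\<^bsub>Perm G\<^esub> x" if "x \<in> N" for x
    using that by (intro group.inv_equality[OF gB]) auto
  have gC: "group (circ_group ?B)"
  proof (rule groupI)
    fix x assume "x \<in> carrier (circ_group ?B)"
    then have x: "x \<in> N" by (simp add: circ_group_def)
    show "\<exists>y\<in>carrier (circ_group ?B). y \<otimes>\<^bsub>circ_group ?B\<^esub> x = \<one>\<^bsub>circ_group ?B\<^esub>"
      using x aN[OF x] ca[OF S.one_closed]
      by (intro bexI[of _ "?c (inv\<^bsub>G\<^esub> (?a x))"]) (simp_all add: circ_group_def circ cN ac a1)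
  qed (auto simp: circ_group_def circ cN aN ac ca a1 m_assoc)
  have lr: "left_reg G g \<in> carrier (Perm G)" if "g \<in> carrier G" for g
  proof -
    have "bij_betw (left_reg G g) (carrier G) (carrier G)"
      by (rule bij_betw_byWitness[where f' = "\<lambda>x. inv\<^bsub>G\<^esub> g \<otimes>\<^bsub>G\<^esub> x"])
         (use that in \<open>auto simp: left_reg_def m_assoc[symmetric]\<close>)
    thus ?thesis by (simp add: BijGroup_def Bij_def left_reg_def)
  qed
  have lr_inv: "inv\<^bsub>Perm G\<^esub> (left_reg G g) = left_reg G (inv\<^bsub>G\<^esub> g)" if "g \<in> carrier G" for g
  proof (rule P.inv_equality)
    show "left_reg G (inv\<^bsub>G\<^esub> g) \<otimes>\<^bsub>Perm G\<^esub> left_reg G g = \<one>\<^bsub>Perm G\<^esub>"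
      using lr[OF that] lr[OF inv_closed[OF that]] that
      by (auto simp: BijGroup_def compose_def left_reg_def m_assoc[symmetric] fun_eq_iff)
  qed (use that lr in auto)
  have left_reg_closed: "left_reg G g t \<in> carrier G"
    if "g \<in> carrier G" "t \<in> carrier G" for g t
    using that by (simp add: left_reg_def)
  have act: "perm_act G g p t = g \<otimes>\<^bsub>G\<^esub> p (inv\<^bsub>G\<^esub> g \<otimes>\<^bsub>G\<^esub> t)"
    if "g \<in> carrier G" "p \<in> N" "t \<in> carrier G" for g p t
  proof -
    have "p s \<in> carrier G" if "s \<in> carrier G" for s
      using that \<open>p \<in> N\<close> NB Bij_imp_funcset by fastforce
    moreover have "perm_act G g p t = left_reg G g (p (left_reg G (inv\<^bsub>G\<^esub> g) t))"
      using that lr[OF that(1)] lr[OF inv_closed[OF that(1)]] S.mem_carrier[OF that(2)]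
      unfolding perm_act_def lr_inv[OF that(1)] by (simp add: app P.m_closed left_reg_closed)
    ultimately show ?thesis using that by (simp add: left_reg_def)
  qed
  have pact: "perm_act G g p \<in> N" if "g \<in> carrier G" "p \<in> N" for g p
    using that assms(4) by (auto simp: stable_under_def)
  have circ_act: "circ ?B x y = perm_act G (?a x) y \<otimes>\<^bsub>Perm G\<^esub> x" if "x \<in> N" "y \<in> N" for x y
  proof -
    have "?a (perm_act G (?a x) y \<otimes>\<^bsub>Perm G\<^esub> x) = perm_act G (?a x) y (?a x)"
      using that pact aN by (simp add: base_eval_def app)
    also have "\<dots> = ?a x \<otimes>\<^bsub>G\<^esub> ?a y" using that aN by (simp add: act base_eval_def[of G y])
    finally have "?c (?a x \<otimes>\<^bsub>G\<^esub> ?a y) = ?c (?a (perm_act G (?a x) y \<otimes>\<^bsub>Perm G\<^esub> x))" by simp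
    also have "\<dots> = perm_act G (?a x) y \<otimes>\<^bsub>Perm G\<^esub> x"
      using that pact aN by (intro ca) auto
    finally show ?thesis by (simp add: circ)
  qed
  have cancel: "inv\<^bsub>Perm G\<^esub> x \<otimes>\<^bsub>Perm G\<^esub> (x \<otimes>\<^bsub>Perm G\<^esub> y) = y"
    if "x \<in> carrier (Perm G)" "y \<in> carrier (Perm G)" for x y
    using that by (simp add: P.m_assoc[symmetric])
  have cancel': "x \<otimes>\<^bsub>Perm G\<^esub> (inv\<^bsub>Perm G\<^esub> x \<otimes>\<^bsub>Perm G\<^esub> y) = y"
    if "x \<in> carrier (Perm G)" "y \<in> carrier (Perm G)" for x y
    using that by (simp add: P.m_assoc[symmetric])
  have hom: "perm_act G g (y \<otimes>\<^bsub>Perm G\<^esub> z) = perm_act G g y \<otimes>\<^bsub>Perm G\<^esub> perm_act G g z"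
    if "g \<in> carrier G" "y \<in> N" "z \<in> N" for g y z
    using that lr[OF that(1)] by (simp add: perm_act_def P.m_assoc cancel)
  show ?thesis
  proof (intro skew_brace.intro skew_brace_axioms.intro gB gC)
    show "finite (carrier ?B)" using bij assms(2) by (simp add: bij_betw_finite)
    fix x y z assume "x \<in> carrier ?B" "y \<in> carrier ?B" "z \<in> carrier ?B"
    then have xyz: "x \<in> N" "y \<in> N" "z \<in> N" by auto
    note m = pact[OF aN[OF xyz(1)]]
    have c: "x \<in> carrier (Perm G)" "perm_act G (?a x) y \<in> carrier (Perm G)"
      "perm_act G (?a x) z \<in> carrier (Perm G)"
      using xyz m by auto
    show "x \<circ>\<^sub>b\<^bsub>?B\<^esub> (y \<otimes>\<^bsub>?B\<^esub> z) = (x \<circ>\<^sub>b\<^bsub>?B\<^esub> y) \<otimes>\<^bsub>?B\<^esub> inv\<^bsub>?B\<^esub> x \<otimes>\<^bsub>?B\<^esub> (x \<circ>\<^sub>b\<^bsub>?B\<^esub> z)"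
      using xyz c by (simp add: circ_act invB hom aN P.m_assoc cancel')
  qed
qed

end

theory Submission
  imports Defs
begin

text \<open>
  Write \<open>a \<eta> = \<eta>[\<one>]\<close> for \<open>\<eta>\<close> in a regular \<open>G\<close>-stable subgroup \<open>N\<close>. The action of \<open>G\<close> on \<open>N\<close> is
  encoded in the brace of \<open>N\<close>, because \<open>\<eta> \<circ> \<pi>\<close> is the product of \<open>a \<eta>\<close> acting on \<open>\<pi>\<close> with \<open>\<eta>\<close>
  (lemma \<open>circ_brace_of\<close>), while \<open>a\<close> identifies the second group of the brace with \<open>G\<close>.
  A brace isomorphism \<open>f : N \<rightarrow> M\<close> therefore transports to an automorphism \<open>\<phi>\<close> of \<open>G\<close>
  (lemma \<open>brace_iso_induces_auto\<close>), and it is \<open>\<phi>\<close>-semilinear: \<open>f\<close> turns the action of \<open>\<sigma>\<close> on \<open>N\<close>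
  into that of \<open>\<phi> \<sigma>\<close> on \<open>M\<close> (lemma \<open>brace_iso_semilinear\<close>).

  If \<open>\<phi>\<close> is conjugation by some \<open>g\<close>, the twist can be undone inside the action itself: following \<open>f\<close>
  by the action of \<open>inv g\<close>, which is a group automorphism of \<open>M\<close> by stability, gives a \<open>G\<close>-equivariant
  isomorphism. When all automorphisms of \<open>G\<close> are inner, every brace isomorphism can be corrected
  in this way.
\<close>

section \<open>The action of a group on its permutations\<close>

lemma carrier_Perm [simp]: "carrier (Perm G) = Bij (carrier G)"
  by (simp add: BijGroup_def)

lemma Perm_apply:
  assumes "x \<in> Bij (carrier G)" "y \<in> Bij (carrier G)" "t \<in> carrier G"
  shows "(x \<otimes>\<^bsub>Perm G\<^esub> y) t = x (y t)"
  using assms by (simp add: BijGroup_def compose_def)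

context group
begin

lemma left_reg_Bij:
  assumes "g \<in> carrier G"
  shows "left_reg G g \<in> Bij (carrier G)"
proof -
  have "bij_betw (left_reg G g) (carrier G) (carrier G)"
    by (rule bij_betw_byWitness[where f' = "\<lambda>x. inv g \<otimes> x"])
       (use assms in \<open>auto simp: left_reg_def m_assoc[symmetric]\<close>)
  thus ?thesis by (simp add: Bij_def left_reg_def)
qed

lemma left_reg_mult:
  assumes "g \<in> carrier G" "h \<in> carrier G"
  shows "left_reg G (g \<otimes> h) = left_reg G g \<otimes>\<^bsub>Perm G\<^esub> left_reg G h"
  using assms left_reg_Bij[OF assms(1)] left_reg_Bij[OF assms(2)]
  by (auto simp: BijGroup_def compose_def left_reg_def m_assoc fun_eq_iff)

lemma left_reg_one: "left_reg G \<one> = \<one>\<^bsub>Perm G\<^esub>"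
  by (auto simp: BijGroup_def left_reg_def fun_eq_iff)

lemma perm_act_Bij:
  assumes "g \<in> carrier G" "p \<in> Bij (carrier G)"
  shows "perm_act G g p \<in> Bij (carrier G)"
proof -
  interpret P: group "Perm G" by (rule group_BijGroup)
  show ?thesis
    using left_reg_Bij[OF assms(1)] assms P.m_closed P.inv_closed
    unfolding perm_act_def by (metis carrier_Perm)
qed

lemma perm_act_mult:
  assumes "g \<in> carrier G" "p \<in> Bij (carrier G)" "q \<in> Bij (carrier G)"
  shows "perm_act G g (p \<otimes>\<^bsub>Perm G\<^esub> q) = perm_act G g p \<otimes>\<^bsub>Perm G\<^esub> perm_act G g q"
proof -
  interpret P: group "Perm G" by (rule group_BijGroup)
  have L: "left_reg G g \<in> carrier (Perm G)" using left_reg_Bij[OF assms(1)] by simp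
  have pq: "p \<in> carrier (Perm G)" "q \<in> carrier (Perm G)" using assms by simp_all
  show ?thesis
    using L pq unfolding perm_act_def
    by (simp add: P.m_assoc P.inv_solve_left del: carrier_Perm)
qed

lemma perm_act_one:
  assumes "p \<in> Bij (carrier G)"
  shows "perm_act G \<one> p = p"
proof -
  interpret P: group "Perm G" by (rule group_BijGroup)
  show ?thesis using assms by (simp add: perm_act_def left_reg_one)
qed

lemma perm_act_comp:
  assumes "g \<in> carrier G" "h \<in> carrier G" "p \<in> Bij (carrier G)"
  shows "perm_act G (g \<otimes> h) p = perm_act G g (perm_act G h p)"
proof -
  interpret P: group "Perm G" by (rule group_BijGroup)
  have L: "left_reg G g \<in> carrier (Perm G)" "left_reg G h \<in> carrier (Perm G)"
    "p \<in> carrier (Perm G)"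
    using left_reg_Bij assms by simp_all
  show ?thesis
    using L assms unfolding perm_act_def
    by (simp add: left_reg_mult P.m_assoc P.inv_mult_group del: carrier_Perm)
qed

text \<open>By its definition as a conjugate, \<open>g\<close> acting on \<open>p\<close>, composed with \<open>left_reg G g\<close>, is
  \<open>left_reg G g\<close> composed with \<open>p\<close>; evaluate this at \<open>\<one>\<close>.\<close>

lemma perm_act_apply_self:
  assumes "g \<in> carrier G" "p \<in> Bij (carrier G)"
  shows "perm_act G g p g = g \<otimes> p \<one>"
proof -
  interpret P: group "Perm G" by (rule group_BijGroup)
  have L: "left_reg G g \<in> carrier (Perm G)" "p \<in> carrier (Perm G)"
    using left_reg_Bij assms by simp_all
  have "perm_act G g p \<otimes>\<^bsub>Perm G\<^esub> left_reg G g = left_reg G g \<otimes>\<^bsub>Perm G\<^esub> p"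
    using L unfolding perm_act_def by (simp add: P.m_assoc del: carrier_Perm)
  hence "(perm_act G g p \<otimes>\<^bsub>Perm G\<^esub> left_reg G g) \<one> = (left_reg G g \<otimes>\<^bsub>Perm G\<^esub> p) \<one>"
    by simp
  moreover have "p \<one> \<in> carrier G" using assms(2) Bij_imp_funcset by fastforce
  ultimately show ?thesis
    using assms left_reg_Bij[OF assms(1)] perm_act_Bij[OF assms]
    by (simp add: Perm_apply left_reg_def)
qed

section \<open>The action as part of the brace structure\<close>

lemma regular_subgroup_Bij:
  assumes "regular_subgroup N G" "\<eta> \<in> N"
  shows "\<eta> \<in> Bij (carrier G)"
  using assms subgroup.mem_carrier unfolding regular_subgroup_def by fastforce

lemma base_eval_circ:
  assumes "regular_subgroup N G" "\<eta> \<in> N" "\<pi> \<in> N"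
  shows "circ (brace_of G N) \<eta> \<pi> \<in> N"
    and "base_eval G (circ (brace_of G N) \<eta> \<pi>) = base_eval G \<eta> \<otimes> base_eval G \<pi>"
proof -
  have bij: "bij_betw (base_eval G) N (carrier G)"
    by (rule bij_betw_base_eval[OF is_group assms(1)])
  have "base_eval G \<eta> \<otimes> base_eval G \<pi> \<in> base_eval G ` N"
    using bij assms(2,3) by (auto simp: bij_betw_def)
  thus "circ (brace_of G N) \<eta> \<pi> \<in> N"
    and "base_eval G (circ (brace_of G N) \<eta> \<pi>) = base_eval G \<eta> \<otimes> base_eval G \<pi>"
    by (simp_all add: brace_of_def inv_into_into f_inv_into_f)
qed

text \<open>A member of \<open>N\<close> is determined by its value at \<open>\<one>\<close>, so it suffices to compare values there.\<close>

lemma circ_brace_of: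
  assumes "regular_subgroup N G" "stable_under N G" "\<eta> \<in> N" "\<pi> \<in> N"
  shows "circ (brace_of G N) \<eta> \<pi> = perm_act G (base_eval G \<eta>) \<pi> \<otimes>\<^bsub>Perm G\<^esub> \<eta>"
proof -
  interpret S: subgroup N "Perm G" using assms(1) by (simp add: regular_subgroup_def)
  have bij: "bij_betw (base_eval G) N (carrier G)"
    by (rule bij_betw_base_eval[OF is_group assms(1)])
  have g: "base_eval G \<eta> \<in> carrier G" using bij assms(3) by (rule bij_betw_apply)
  have B: "\<eta> \<in> Bij (carrier G)" "\<pi> \<in> Bij (carrier G)"
    using assms regular_subgroup_Bij by auto
  have N: "perm_act G (base_eval G \<eta>) \<pi> \<in> N"
    using assms(2,4) g by (simp add: stable_under_def)
  have "base_eval G (perm_act G (base_eval G \<eta>) \<pi> \<otimes>\<^bsub>Perm G\<^esub> \<eta>)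
      = perm_act G (base_eval G \<eta>) \<pi> (base_eval G \<eta>)"
    using Perm_apply[OF perm_act_Bij[OF g B(2)] B(1) one_closed] by (simp add: base_eval_def)
  also have "\<dots> = base_eval G \<eta> \<otimes> base_eval G \<pi>"
    using perm_act_apply_self[OF g B(2)] by (simp add: base_eval_def)
  finally show ?thesis
    using base_eval_circ[OF assms(1,3,4)] bij S.m_closed[OF N assms(3)]
    by (metis bij_betw_def inj_onD)
qed

section \<open>Brace isomorphisms twist the action by an automorphism\<close>

text \<open>The automorphism is the map induced by \<open>f\<close> on values at \<open>\<one>\<close>, made extensional so that it is
  a member of \<open>auto G\<close>.\<close>

lemma brace_iso_induces_auto:
  assumes "regular_subgroup N G" "regular_subgroup M G"
    and f: "f \<in> brace_iso (brace_of G N) (brace_of G M)"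
  obtains \<phi> where "\<phi> \<in> auto G"
    and "\<And>\<eta>. \<eta> \<in> N \<Longrightarrow> \<phi> (base_eval G \<eta>) = base_eval G (f \<eta>)"
proof
  let ?a = "base_eval G"
  let ?\<phi> = "\<lambda>x\<in>carrier G. ?a (f (inv_into N ?a x))"
  have bN: "bij_betw ?a N (carrier G)" and bM: "bij_betw ?a M (carrier G)"
    by (rule bij_betw_base_eval[OF is_group]; fact)+
  have bf: "bij_betw f N M"
    using f by (simp add: brace_iso_def iso_def brace_of_def)
  have fc: "f (circ (brace_of G N) \<eta> \<pi>) = circ (brace_of G M) (f \<eta>) (f \<pi>)"
    if "\<eta> \<in> N" "\<pi> \<in> N" for \<eta> \<pi>
  proof -
    have "carrier (brace_of G N) = N" by (simp add: brace_of_def)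
    thus ?thesis using f that by (auto simp: brace_iso_def iso_def hom_def circ_group_def)
  qed
  show eq: "?\<phi> (?a \<eta>) = ?a (f \<eta>)" if "\<eta> \<in> N" for \<eta>
    using bN that by (simp add: bij_betw_apply bij_betw_inv_into_left)
  have "bij_betw (\<lambda>x. ?a (f (inv_into N ?a x))) (carrier G) (carrier G)"
    using bij_betw_trans[OF bij_betw_trans[OF bij_betw_inv_into[OF bN] bf] bM]
    by (simp add: comp_def)
  hence b\<phi>: "bij_betw ?\<phi> (carrier G) (carrier G)" by (simp cong: bij_betw_cong)
  have "?\<phi> (x \<otimes> y) = ?\<phi> x \<otimes> ?\<phi> y" if xy: "x \<in> carrier G" "y \<in> carrier G" for x y
  proof -
    obtain \<eta> \<pi> where N: "\<eta> \<in> N" "\<pi> \<in> N" and "x = ?a \<eta>" "y = ?a \<pi>"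
      using bN xy by (metis bij_betw_def imageE)
    moreover have "f \<eta> \<in> M" "f \<pi> \<in> M" using bf N by (auto simp: bij_betw_def)
    ultimately show ?thesis
      by (metis N eq fc assms(1,2) base_eval_circ)
  qed
  with b\<phi> show "?\<phi> \<in> auto G"
    unfolding auto_def hom_def Bij_def using bij_betw_apply[OF b\<phi>] by (simp add: Pi_def)
qed

text \<open>Apply \<open>f\<close> to \<open>\<eta> \<circ> \<pi>\<close>, expressed through the action as in \<open>circ_brace_of\<close>, choosing \<open>\<eta>\<close> with
  value \<open>\<sigma>\<close> at \<open>\<one>\<close>; the factor \<open>f \<eta>\<close> cancels.\<close>

lemma brace_iso_semilinear:
  assumes N: "regular_subgroup N G" "stable_under N G"
    and M: "regular_subgroup M G" "stable_under M G"
    and f: "f \<in> brace_iso (brace_of G N) (brace_of G M)"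
    and \<phi>: "\<And>\<eta>. \<eta> \<in> N \<Longrightarrow> \<phi> (base_eval G \<eta>) = base_eval G (f \<eta>)"
    and "\<sigma> \<in> carrier G" "\<pi> \<in> N"
  shows "f (perm_act G \<sigma> \<pi>) = perm_act G (\<phi> \<sigma>) (f \<pi>)"
proof -
  interpret P: group "Perm G" by (rule group_BijGroup)
  have bN: "bij_betw (base_eval G) N (carrier G)" and bM: "bij_betw (base_eval G) M (carrier G)"
    by (rule bij_betw_base_eval[OF is_group]; fact)+
  obtain \<eta> where \<eta>: "\<eta> \<in> N" "\<sigma> = base_eval G \<eta>"
    using bN assms(7) by (metis bij_betw_def imageE)
  have [simp]: "carrier (brace_of G N) = N" "mult (brace_of G N) = mult (Perm G)"
    "mult (brace_of G M) = mult (Perm G)" "carrier (brace_of G M) = M"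
    by (simp_all add: brace_of_def)
  have f_closed: "f x \<in> M" if "x \<in> N" for x
    using f that by (auto simp: brace_iso_def iso_def hom_def)
  have f_mult: "f (x \<otimes>\<^bsub>Perm G\<^esub> y) = f x \<otimes>\<^bsub>Perm G\<^esub> f y" if "x \<in> N" "y \<in> N" for x y
    using f that by (auto simp: brace_iso_def iso_def hom_def)
  have f_circ: "f (circ (brace_of G N) x y) = circ (brace_of G M) (f x) (f y)"
    if "x \<in> N" "y \<in> N" for x y
    using f that by (auto simp: brace_iso_def iso_def hom_def circ_group_def)
  have act: "perm_act G \<sigma> \<pi> \<in> N"
    using N(2) assms(7,8) by (simp add: stable_under_def)
  have "f (perm_act G \<sigma> \<pi>) \<otimes>\<^bsub>Perm G\<^esub> f \<eta> = f (circ (brace_of G N) \<eta> \<pi>)"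
    using circ_brace_of[OF N \<eta>(1) assms(8)] f_mult[OF act \<eta>(1)] \<eta>(2) by simp
  also have "\<dots> = circ (brace_of G M) (f \<eta>) (f \<pi>)" using f_circ \<eta>(1) assms(8) .
  also have "\<dots> = perm_act G (\<phi> \<sigma>) (f \<pi>) \<otimes>\<^bsub>Perm G\<^esub> f \<eta>"
    using circ_brace_of[OF M f_closed f_closed] \<eta> assms(8) \<phi> by simp
  finally have eq: "f (perm_act G \<sigma> \<pi>) \<otimes>\<^bsub>Perm G\<^esub> f \<eta> = perm_act G (\<phi> \<sigma>) (f \<pi>) \<otimes>\<^bsub>Perm G\<^esub> f \<eta>" .
  have "\<phi> \<sigma> \<in> carrier G"
    using \<eta> \<phi> bij_betw_apply[OF bM f_closed[OF \<eta>(1)]] by simp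
  hence "perm_act G (\<phi> \<sigma>) (f \<pi>) \<in> carrier (Perm G)"
    using perm_act_Bij regular_subgroup_Bij[OF M(1) f_closed[OF assms(8)]] by simp
  moreover have "f (perm_act G \<sigma> \<pi>) \<in> carrier (Perm G)" "f \<eta> \<in> carrier (Perm G)"
    using regular_subgroup_Bij[OF M(1)] f_closed act \<eta>(1) by simp_all
  ultimately show ?thesis using eq P.right_cancel by blast
qed

lemma perm_act_stable_bij:
  assumes "regular_subgroup M G" "stable_under M G" "g \<in> carrier G"
  shows "bij_betw (perm_act G g) M M"
proof (rule bij_betw_byWitness[where f' = "perm_act G (inv g)"])
  show "perm_act G g ` M \<subseteq> M" "perm_act G (inv g) ` M \<subseteq> M"
    using assms by (auto simp: stable_under_def)
  show "\<forall>p\<in>M. perm_act G (inv g) (perm_act G g p) = p"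
    "\<forall>p\<in>M. perm_act G g (perm_act G (inv g) p) = p"
    using assms regular_subgroup_Bij
    by (simp_all flip: perm_act_comp add: perm_act_one)
qed

text \<open>The action of \<open>inv g\<close> undoes the twist by conjugation with \<open>g\<close>, because
  \<open>inv g \<otimes> (g \<otimes> \<sigma> \<otimes> inv g) = \<sigma> \<otimes> inv g\<close>. Stability of \<open>M\<close> keeps the corrected map inside \<open>M\<close>.\<close>

lemma G_isomorphic_of_inner_twist:
  assumes "regular_subgroup M G" "stable_under M G" "g \<in> carrier G"
    and f: "f \<in> iso (Perm G\<lparr>carrier := N\<rparr>) (Perm G\<lparr>carrier := M\<rparr>)"
    and twist: "\<And>\<sigma> \<pi>. \<lbrakk>\<sigma> \<in> carrier G; \<pi> \<in> N\<rbrakk> \<Longrightarrow>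
      f (perm_act G \<sigma> \<pi>) = perm_act G (g \<otimes> \<sigma> \<otimes> inv g) (f \<pi>)"
  shows "G_isomorphic G N M"
  unfolding G_isomorphic_def
proof (intro bexI ballI)
  let ?\<theta> = "\<lambda>\<eta>. perm_act G (inv g) (f \<eta>)"
  have fB: "f \<eta> \<in> Bij (carrier G)" if "\<eta> \<in> N" for \<eta>
    using f that regular_subgroup_Bij[OF assms(1)] by (auto simp: iso_def hom_def)
  have "perm_act G (inv g) \<in> iso (Perm G\<lparr>carrier := M\<rparr>) (Perm G\<lparr>carrier := M\<rparr>)"
    using perm_act_stable_bij[OF assms(1,2) inv_closed[OF assms(3)]] assms(3)
    by (auto simp: iso_def hom_def bij_betw_apply perm_act_mult regular_subgroup_Bij[OF assms(1)])
  from iso_set_trans[OF f this]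
  show "?\<theta> \<in> iso (Perm G\<lparr>carrier := N\<rparr>) (Perm G\<lparr>carrier := M\<rparr>)"
    by (simp add: comp_def)
  fix \<eta> \<sigma> assume "\<eta> \<in> N" "\<sigma> \<in> carrier G"
  then show "?\<theta> (perm_act G \<sigma> \<eta>) = perm_act G \<sigma> (?\<theta> \<eta>)"
    using assms(3) fB by (simp add: twist perm_act_comp[symmetric] m_assoc[symmetric])
qed

end

section \<open>Groups with only inner automorphisms\<close>

theorem corollary4p3:
  fixes G :: "('a, 'm) monoid_scheme" and N M :: "('a \<Rightarrow> 'a) set"
  assumes "group G" and "finite (carrier G)" and "\<not> comm_group G"
    and "auto G = Inn G"
    and "regular_subgroup N G" and "stable_under N G"
    and "regular_subgroup M G" and "stable_under M G"
    and "brace_equivalent G N M"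
  shows "G_isomorphic G N M"
proof -
  interpret group G by fact
  obtain f where f: "f \<in> brace_iso (brace_of G N) (brace_of G M)"
    using assms(9) by (auto simp: brace_equivalent_def)
  obtain \<phi> where \<phi>: "\<phi> \<in> auto G" "\<And>\<eta>. \<eta> \<in> N \<Longrightarrow> \<phi> (base_eval G \<eta>) = base_eval G (f \<eta>)"
    using brace_iso_induces_auto[OF assms(5,7) f] by blast
  obtain g where g: "g \<in> carrier G"
    and inner: "\<phi> = (\<lambda>x\<in>carrier G. g \<otimes>\<^bsub>G\<^esub> x \<otimes>\<^bsub>G\<^esub> inv\<^bsub>G\<^esub> g)"
    using \<phi>(1) assms(4) by (auto simp: Inn_def)
  have "f \<in> iso (Perm G\<lparr>carrier := N\<rparr>) (Perm G\<lparr>carrier := M\<rparr>)"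
    using f by (simp add: brace_iso_def iso_def hom_def brace_of_def)
  then show ?thesis
  proof (rule G_isomorphic_of_inner_twist[OF assms(7,8) g])
    fix \<sigma> \<pi> assume "\<sigma> \<in> carrier G" "\<pi> \<in> N"
    then show "f (perm_act G \<sigma> \<pi>) = perm_act G (g \<otimes>\<^bsub>G\<^esub> \<sigma> \<otimes>\<^bsub>G\<^esub> inv\<^bsub>G\<^esub> g) (f \<pi>)"
      using brace_iso_semilinear[OF assms(5-8) f \<phi>(2)] by (simp add: inner)
  qed
qed

end
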